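(* Fix the external bids $b^e$, and consider either the GSP or the VCG mechanism together with the corresponding weighted directed graph on vertices $s$, $s'$ and $(i,\bar b^c_j)$ ($i\in N_c$, $j\in[d]$) defined in the context. Let $\sigma$ be a directed path from $s$ to $s'$ whose sequence of intermediate nodes is $(1,\bar b^c_{j_1}),\dots,(n_c,\bar b^c_{j_{n_c}})$. Then its length satisfies $$W_\sigma=\sum_{i\in N_c}\bigl(\hat y_i\,r_i(b^c,b^e)-\hat x\,\pi_i(b^c,b^e)\bigr),$$ where $b^c=(\bar b^c_{j_1},\dots,\bar b^c_{j_{n_c}})$. Moreover, for each (decreasingly ordered) bidding strategy $b^c=(\bar b^c_{j_1},\dots,\bar b^c_{j_{n_c}})\in(\mathcal{B}^c)^{n_c}$, there exists a corresponding directed path from $s$ to $s'$ whose intermediate nodes are $(1,\bar b^c_{j_1}),\dots,(n_c,\bar b^c_{j_{n_c}})$.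
   Context: Ad auction. There are colluders $N_c=\{1,\dots,n_c\}$ and external agents $N_e=\{1,\dots,n_e\}$, $n=n_c+n_e$ agents in total, and slots $\{1,\dots,m\}$, $m\le n$, with click-through rates $1\ge\lambda_1\ge\dots\ge\lambda_m\ge 0$; set $\lambda_k=0$ for $k>m$. Colluder $i$ has valuation $v_i\in[0,1]$. Colluders' bids are $b^c\in[0,1]^{n_c}$, external bids are $b^e=(b^e_1,\dots,b^e_{n_e})\in[0,1]^{n_e}$, indexed so that $b^e_1\ge\dots\ge b^e_{n_e}$. Given $b=(b^c,b^e)$, agents are ranked by decreasing bid, and the agent ranked $k$-th gets slot $k$ for $k\le m$. Ties between a colluder and an external agent are broken in favor of the colluder, ties among colluders in favor of the smaller index. Write $b_{(k)}$ for the $k$-th highest bid ($b_{(n+1)}=0$). An agent $i$ ranked $k$-th has expected revenue $r_i(b)=\lambda_k v_i$, and expected payment - GSP mechanism: $\pi_i(b)=\lambda_k b_{(k+1)}$; - VCG mechanism: $\pi_i(b)=\sum_{j=k+1}^{m+1}b_{(j)}(\lambda_{j-1}-\lambda_j)$ if $k\le m$, and $0$ otherwise. Weights and bids. Let $\hat y_i\ge0$ ($i\in N_c$), $\hat x\ge0$, with colluders indexed so that $\hat y_1v_1\ge\dots\ge\hat y_{n_c}v_{n_c}$, and let $\mathcal{B}^c=\{\bar b^c_1,\dots,\bar b^c_d\}\subset[0,1]$ be $d$ different bid values with $\bar b^c_1\ge\dots\ge\bar b^c_d$. Bidding strategies are taken with bids in decreasing order: $b^c_1\ge\dots\ge b^c_{n_c}$.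 Graph. Vertices: a source $s$, a sink $s'$ and a node $(i,\bar b^c_j)$ for each $i\in N_c$, $j\in[d]$. Arcs: from $s$ to $(1,\bar b^c_j)$ for every $j\in[d]$; from $(i,\bar b^c_{j'})$ to $(i+1,\bar b^c_j)$ for every $1\le i<n_c$ and $j',j\in[d]$ with $j\ge j'$; from $(n_c,\bar b^c_{j})$ to $s'$ for every $j\in[d]$. Arcs out of $s$ have weight $0$. The arc leaving node $(i,\bar b^c_{j'})$ toward $(i+1,\bar b^c_j)$ (or toward $s'$ if $i=n_c$) has the weight $w$ given below, where $b^c_i=\bar b^c_{j'}$ and $b^c_{i+1}=\bar b^c_j$ (with $b^c_{n_c+1}=0$ for $i=n_c$), and $n(b^c_i)=|\{j\in N_e: b^e_j>b^c_i\}|$: - GSP: $w=\lambda_{i+n(b^c_i)}\bigl(\hat y_iv_i-\hat x\max\{b^c_{i+1},\max_{j:\,b^e_j\le b^c_i}b^e_j\}\bigr)$ (a maximum over the empty set is $0$); - VCG: $w=\hat y_i\lambda_{i+n(b^c_i)}v_i-\hat x\Bigl[(i-1)\,b^c_i\,(\lambda_{i+n(b^c_i)-1}-\lambda_{i+n(b^c_i)})+\sum_{h:\,b^e_h\in(b^c_{i+1},b^c_i]}i\,b^e_h(\lambda_{h+i-1}-\lambda_{h+i})\Bigr]$ (the first bracketed term is $0$ for $i=1$). The length $W_\sigma$ of a directed path $\sigma$ from $s$ to $s'$ is the sum of the weights of its arcs. *)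

theory Defs
  imports Complex_Main "Graph_Theory.Weighted_Graph"
begin

section \<open>The ad auction\<close>

text \<open>
  Agents and slots are numbered from 1, so vectors are functions on \<open>nat\<close> of which only the
  values at \<open>{1..nc}\<close> (colluders), \<open>{1..ne}\<close> (external agents) and \<open>{1..d}\<close> (bid values) matter.
  The click-through rates \<open>lam\<close> are understood to be extended by \<open>lam k = 0\<close> beyond the last slot.
\<close>

datatype mechanism = GSP | VCG

datatype agent = Colluder nat | External nat

definition agents :: "nat \<Rightarrow> nat \<Rightarrow> agent set" where
  "agents nc ne = Colluder ` {1..nc} \<union> External ` {1..ne}"

fun bid_of :: "(nat \<Rightarrow> real) \<Rightarrow> (nat \<Rightarrow> real) \<Rightarrow> agent \<Rightarrow> real" where
  "bid_of bc be (Colluder i) = bc i"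
| "bid_of bc be (External h) = be h"

text \<open>
  \<open>precedes_in_tie a a'\<close>: with equal bids, \<open>a\<close> is ranked before \<open>a'\<close>. The order among external
  agents has no influence on the revenue and the payment of a colluder.
\<close>

fun precedes_in_tie :: "agent \<Rightarrow> agent \<Rightarrow> bool" where
  "precedes_in_tie (Colluder i) (Colluder i') \<longleftrightarrow> i < i'"
| "precedes_in_tie (Colluder i) (External h) \<longleftrightarrow> True"
| "precedes_in_tie (External h) (Colluder i) \<longleftrightarrow> False"
| "precedes_in_tie (External h) (External h') \<longleftrightarrow> h < h'"

definition outranks :: "(nat \<Rightarrow> real) \<Rightarrow> (nat \<Rightarrow> real) \<Rightarrow> agent \<Rightarrow> agent \<Rightarrow> bool" where
  "outranks bc be a a' \<longleftrightarrow>
     bid_of bc be a > bid_of bc be a' \<or> bid_of bc be a = bid_of bc be a' \<and> precedes_in_tie a a'"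

definition rank_of ::
  "nat \<Rightarrow> nat \<Rightarrow> (nat \<Rightarrow> real) \<Rightarrow> (nat \<Rightarrow> real) \<Rightarrow> agent \<Rightarrow> nat" where
  "rank_of nc ne bc be a = card {a' \<in> agents nc ne. outranks bc be a' a} + 1"

text \<open>The \<open>k\<close>-th highest bid, counted from \<open>k = 1\<close> and with multiplicity; 0 for \<open>k > nc + ne\<close>.\<close>

definition kth_bid ::
  "nat \<Rightarrow> nat \<Rightarrow> (nat \<Rightarrow> real) \<Rightarrow> (nat \<Rightarrow> real) \<Rightarrow> nat \<Rightarrow> real" where
  "kth_bid nc ne bc be k =
     (if k \<in> {1..nc + ne}
      then rev (sort (map bc [1..<nc + 1] @ map be [1..<ne + 1])) ! (k - 1)
      else 0)"

definition revenue ::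
  "nat \<Rightarrow> nat \<Rightarrow> (nat \<Rightarrow> real) \<Rightarrow> (nat \<Rightarrow> real) \<Rightarrow> (nat \<Rightarrow> real) \<Rightarrow> (nat \<Rightarrow> real) \<Rightarrow> nat \<Rightarrow> real"
  where
  "revenue nc ne lam v bc be i = lam (rank_of nc ne bc be (Colluder i)) * v i"

fun payment ::
  "mechanism \<Rightarrow> nat \<Rightarrow> nat \<Rightarrow> nat \<Rightarrow> (nat \<Rightarrow> real) \<Rightarrow> (nat \<Rightarrow> real) \<Rightarrow> (nat \<Rightarrow> real) \<Rightarrow> agent \<Rightarrow> real"
  where
  "payment GSP nc ne m lam bc be a =
     (let k = rank_of nc ne bc be a in lam k * kth_bid nc ne bc be (k + 1))"
| "payment VCG nc ne m lam bc be a =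
     (let k = rank_of nc ne bc be a in
        if k \<le> m then \<Sum>j = k + 1..m + 1. kth_bid nc ne bc be j * (lam (j - 1) - lam j)
        else 0)"


section \<open>The bid graph\<close>

datatype vertex = Source | Sink | Node nat real

definition bid_graph ::
  "nat \<Rightarrow> nat \<Rightarrow> (nat \<Rightarrow> real) \<Rightarrow> (vertex, vertex \<times> vertex) pre_digraph" where
  "bid_graph nc d bb =
     \<lparr> verts = {Source, Sink} \<union> {Node i (bb j) | i j. i \<in> {1..nc} \<and> j \<in> {1..d}},
       arcs = {(Source, Node 1 (bb j)) | j. j \<in> {1..d}}
            \<union> {(Node i (bb j'), Node (i + 1) (bb j)) | i j' j.
                 1 \<le> i \<and> i < nc \<and> j' \<in> {1..d} \<and> j \<in> {1..d} \<and> j' \<le> j}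
            \<union> {(Node nc (bb j), Sink) | j. j \<in> {1..d}},
       tail = fst,
       head = snd \<rparr>"

lemma wf_digraph_bid_graph:
  assumes "1 \<le> nc"
  shows "wf_digraph (bid_graph nc d bb)"
proof
  fix e
  assume e: "e \<in> arcs (bid_graph nc d bb)"
  show "tail (bid_graph nc d bb) e \<in> verts (bid_graph nc d bb)"
    using e assms by (fastforce simp: bid_graph_def)
  show "head (bid_graph nc d bb) e \<in> verts (bid_graph nc d bb)"
    using e assms by (fastforce simp: bid_graph_def)
qed

definition n_above :: "nat \<Rightarrow> (nat \<Rightarrow> real) \<Rightarrow> real \<Rightarrow> nat" where
  "n_above ne be b = card {h \<in> {1..ne}. be h > b}"

definition max_below :: "nat \<Rightarrow> (nat \<Rightarrow> real) \<Rightarrow> real \<Rightarrow> real" where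
  "max_below ne be b =
     (let S = be ` {h \<in> {1..ne}. be h \<le> b} in if S = {} then 0 else Max S)"

text \<open>
  In \<open>node_weight M ne lam v y x be i b b'\<close>, \<open>b\<close> is the bid of colluder \<open>i\<close> and \<open>b'\<close> the bid of
  colluder \<open>i + 1\<close>. For \<open>i = 1\<close> the factor \<open>real (i - 1)\<close> cancels the term containing
  \<open>lam (i + n_above ne be b - 1)\<close>, whose argument may then be 0, which is not a slot.
\<close>

fun node_weight ::
  "mechanism \<Rightarrow> nat \<Rightarrow> (nat \<Rightarrow> real) \<Rightarrow> (nat \<Rightarrow> real) \<Rightarrow> (nat \<Rightarrow> real) \<Rightarrow> real \<Rightarrow> (nat \<Rightarrow> real)
    \<Rightarrow> nat \<Rightarrow> real \<Rightarrow> real \<Rightarrow> real" where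
  "node_weight GSP ne lam v y x be i b b' =
     lam (i + n_above ne be b) * (y i * v i - x * max b' (max_below ne be b))"
| "node_weight VCG ne lam v y x be i b b' =
     y i * lam (i + n_above ne be b) * v i
     - x * (real (i - 1) * b * (lam (i + n_above ne be b - 1) - lam (i + n_above ne be b))
            + (\<Sum>h \<in> {h \<in> {1..ne}. be h \<in> {b'<..b}}.
                 real i * be h * (lam (h + i - 1) - lam (h + i))))"

text \<open>Only the values at arcs of \<open>bid_graph\<close> matter.\<close>

fun arc_weight ::
  "mechanism \<Rightarrow> nat \<Rightarrow> (nat \<Rightarrow> real) \<Rightarrow> (nat \<Rightarrow> real) \<Rightarrow> (nat \<Rightarrow> real) \<Rightarrow> real \<Rightarrow> (nat \<Rightarrow> real)
    \<Rightarrow> vertex \<times> vertex \<Rightarrow> real" where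
  "arc_weight M ne lam v y x be (Node i b, Node i' b') = node_weight M ne lam v y x be i b b'"
| "arc_weight M ne lam v y x be (Node i b, Sink) = node_weight M ne lam v y x be i b 0"
| "arc_weight M ne lam v y x be _ = 0"

text \<open>A path is represented by its list of arcs.\<close>

definition path_through ::
  "nat \<Rightarrow> nat \<Rightarrow> (nat \<Rightarrow> real) \<Rightarrow> (vertex \<times> vertex) awalk \<Rightarrow> (nat \<Rightarrow> real) \<Rightarrow> bool" where
  "path_through nc d bb p bc \<longleftrightarrow>
     pre_digraph.apath (bid_graph nc d bb) Source p Sink \<and>
     pre_digraph.awalk_verts (bid_graph nc d bb) Source p =
       Source # map (\<lambda>i. Node i (bc i)) [1..<nc + 1] @ [Sink]"

end

theory Submission
  imports Defs "HOL-Library.Multiset"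
begin

text \<open>
  Listing the agents by rank sorts their bids, so the \<open>j\<close>-th highest bid is the bid of the agent of
  rank \<open>j\<close>. When the colluders bid in decreasing order, colluder \<open>i\<close> has rank \<open>i + n(b\<^sub>i)\<close>, and the
  next rank is held either by colluder \<open>i + 1\<close> or by the highest external agent bidding at most
  \<open>b\<^sub>i\<close>, which gives the GSP weights arc by arc. The VCG weights agree with the payments only after
  summation over the colluders: exchanging the sums charges every agent \<open>a\<close> of rank \<open>j\<close> with its bid
  times \<open>\<lambda>\<^bsub>j-1\<^esub> - \<lambda>\<^sub>j\<close> times the number of colluders ranked before \<open>a\<close>. That number is
  \<open>i - 1\<close> if \<open>a\<close> is colluder \<open>i\<close>, and it is the unique \<open>i\<close> with \<open>b\<^bsub>i+1\<^esub> < b\<^sub>a \<le> b\<^sub>i\<close> if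
  \<open>a\<close> is an external agent with a positive bid ranked after some colluder.
\<close>

section \<open>Ranks and order statistics\<close>

lemma finite_agents [simp]: "finite (agents nc ne)"
  by (simp add: agents_def)

lemma sum_agents:
  "(\<Sum>a \<in> agents nc ne. f a) = (\<Sum>i = 1..nc. f (Colluder i)) + (\<Sum>h = 1..ne. f (External h))"
proof -
  have "(\<Sum>a \<in> agents nc ne. f a) =
      (\<Sum>a \<in> Colluder ` {1..nc}. f a) + (\<Sum>a \<in> External ` {1..ne}. f a)"
    unfolding agents_def by (rule sum.union_disjoint) auto
  then show ?thesis
    by (simp add: sum.reindex inj_on_def)
qed

lemma card_agents [simp]: "card (agents nc ne) = nc + ne"
proof -
  have "card (agents nc ne) = (\<Sum>a \<in> agents nc ne. 1)"
    by simp
  also have "\<dots> = nc + ne"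
    unfolding sum_agents by simp
  finally show ?thesis .
qed

lemma mset_upt_one: "mset [1..<n + 1] = mset_set {1..n}"
  by (simp add: atLeastLessThanSuc_atLeastAtMost del: upt_Suc)

text \<open>\<open>kth_bid\<close> sorts a list of bids, whereas ranks live on agents. Passing to
  multisets allows the sorted list to be computed from any enumeration of the agents.\<close>

lemma mset_bids:
  "mset (map bc [1..<nc + 1] @ map be [1..<ne + 1]) =
     image_mset (bid_of bc be) (mset_set (agents nc ne))"
proof -
  have "mset_set (agents nc ne) =
      mset_set (Colluder ` {1..nc}) + mset_set (External ` {1..ne})"
    unfolding agents_def by (rule mset_set_Union) auto
  also have "\<dots> = image_mset Colluder (mset_set {1..nc}) + image_mset External (mset_set {1..ne})"
    by (simp add: image_mset_mset_set inj_on_def)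
  finally have "mset_set (agents nc ne) = \<dots>" .
  then show ?thesis
    by (simp only: mset_append mset_map mset_upt_one image_mset_union image_mset.compositionality)
      (simp add: comp_def)
qed

section \<open>The ranking as a strict linear order, and its order statistics\<close>

lemma not_outranks_self [simp]: "\<not> outranks bc be a a"
  by (cases a) (auto simp: outranks_def)

lemma outranks_trans:
  "outranks bc be a a' \<Longrightarrow> outranks bc be a' a'' \<Longrightarrow> outranks bc be a a''"
  by (cases a; cases a'; cases a'') (auto simp: outranks_def)

lemma outranks_total:
  "a \<noteq> a' \<Longrightarrow> outranks bc be a a' \<or> outranks bc be a' a"
  by (cases a; cases a') (auto simp: outranks_def)

context
  fixes nc ne :: nat and bc be :: "nat \<Rightarrow> real"
begin

text \<open>By transitivity, whatever outranks \<open>a\<close> also outranks \<open>a'\<close>; the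
  agent \<open>a\<close> itself makes the inclusion of the two sets strict.\<close>

lemma outranks_imp_rank_less:
  assumes "a \<in> agents nc ne" "outranks bc be a a'"
  shows "rank_of nc ne bc be a < rank_of nc ne bc be a'"
proof -
  have "{c \<in> agents nc ne. outranks bc be c a} \<subset> {c \<in> agents nc ne. outranks bc be c a'}"
    using assms outranks_trans not_outranks_self by blast
  then show ?thesis
    unfolding rank_of_def by (simp add: psubset_card_mono)
qed

lemma rank_less_iff_outranks:
  assumes "a \<in> agents nc ne" "a' \<in> agents nc ne"
  shows "rank_of nc ne bc be a < rank_of nc ne bc be a' \<longleftrightarrow> outranks bc be a a'"
  by (metis assms outranks_imp_rank_less outranks_total not_less_iff_gr_or_eq)

text \<open>Totality makes the rank injective. An agent does not outrank itself, so all ranks lie in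
  \<open>{1..nc + ne}\<close>, and counting shows that every one of them is taken.\<close>

lemma bij_betw_rank:
  "bij_betw (rank_of nc ne bc be) (agents nc ne) {1..nc + ne}"
proof -
  have inj: "inj_on (rank_of nc ne bc be) (agents nc ne)"
    by (rule inj_onI) (metis outranks_imp_rank_less outranks_total less_irrefl)
  have "rank_of nc ne bc be a \<in> {1..nc + ne}" if "a \<in> agents nc ne" for a
  proof -
    have "{c \<in> agents nc ne. outranks bc be c a} \<subset> agents nc ne"
      using that not_outranks_self by blast
    then have "card {c \<in> agents nc ne. outranks bc be c a} < nc + ne"
      using psubset_card_mono[OF finite_agents] by (metis card_agents)
    then show ?thesis
      by (simp add: rank_of_def)
  qed
  then have "rank_of nc ne bc be ` agents nc ne = {1..nc + ne}"
    by (intro card_subset_eq) (auto simp: card_image[OF inj])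
  with inj show ?thesis
    by (simp add: bij_betw_def)
qed

lemma kth_bid_rank:
  assumes "a \<in> agents nc ne"
  shows "kth_bid nc ne bc be (rank_of nc ne bc be a) = bid_of bc be a"
proof -
  define N where "N = nc + ne"
  define at_rank where "at_rank = the_inv_into (agents nc ne) (rank_of nc ne bc be)"
  define ranked where "ranked = map (bid_of bc be \<circ> at_rank) [1..<N + 1]"
  have bij: "bij_betw at_rank {1..N} (agents nc ne)"
    unfolding at_rank_def N_def by (rule bij_betw_the_inv_into[OF bij_betw_rank])
  have rank_at: "rank_of nc ne bc be (at_rank k) = k" if "k \<in> {1..N}" for k
    using that f_the_inv_into_f_bij_betw[OF bij_betw_rank] unfolding at_rank_def N_def by blast
  have at_mem: "at_rank k \<in> agents nc ne" if "k \<in> {1..N}" for k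
    using bij that by (auto simp: bij_betw_def)
  have desc: "bid_of bc be (at_rank l) \<le> bid_of bc be (at_rank k)"
    if "1 \<le> k" "k < l" "l \<le> N" for k l
  proof -
    have "outranks bc be (at_rank k) (at_rank l)"
      using rank_less_iff_outranks[OF at_mem at_mem, of k l] rank_at[of k] rank_at[of l] that by simp
    then show ?thesis
      by (auto simp: outranks_def)
  qed
  have "sorted (rev ranked)"
    unfolding sorted_rev_iff_nth_mono
  proof (intro allI impI)
    fix k l assume "k \<le> l" "l < length ranked"
    then show "ranked ! l \<le> ranked ! k"
      using desc[of "k + 1" "l + 1"]
      by (cases "k = l") (auto simp: ranked_def add.commute simp del: upt_Suc)
  qed
  moreover have "mset (rev ranked) = mset (map bc [1..<nc + 1] @ map be [1..<ne + 1])"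
  proof -
    have "mset ranked = image_mset (bid_of bc be) (image_mset at_rank (mset_set {1..N}))"
      by (simp only: ranked_def mset_map mset_upt_one image_mset.compositionality)
    also have "image_mset at_rank (mset_set {1..N}) = mset_set (agents nc ne)"
      using bij by (simp add: image_mset_mset_set bij_betw_def)
    finally show ?thesis
      unfolding mset_bids mset_rev .
  qed
  \<comment> \<open>A sorted list is determined by its multiset, so equal bids cause no ambiguity
    even though ranks separate their owners.\<close>
  ultimately have sort: "sort (map bc [1..<nc + 1] @ map be [1..<ne + 1]) = rev ranked"
    by (intro properties_for_sort)
  have "rank_of nc ne bc be a \<in> {1..N}"
    using bij_betw_rank assms unfolding N_def bij_betw_def by blast
  moreover from this have "ranked ! (rank_of nc ne bc be a - 1) =
      bid_of bc be (at_rank (rank_of nc ne bc be a))"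
    by (cases "rank_of nc ne bc be a") (auto simp: ranked_def simp del: upt_Suc)
  moreover have "at_rank (rank_of nc ne bc be a) = a"
    using the_inv_into_f_f[OF bij_betw_imp_inj_on[OF bij_betw_rank] assms] by (simp add: at_rank_def)
  ultimately show ?thesis
    by (simp only: kth_bid_def sort rev_rev_ident N_def if_True)
qed

lemma agent_of_rank:
  assumes "k \<in> {1..nc + ne}"
  obtains a where "a \<in> agents nc ne" "rank_of nc ne bc be a = k"
  using assms bij_betw_imp_surj_on[OF bij_betw_rank] by (metis imageE)

lemma kth_bid_nonneg:
  assumes "\<forall>i \<in> {1..nc}. 0 \<le> bc i" "\<forall>h \<in> {1..ne}. 0 \<le> be h"
  shows "0 \<le> kth_bid nc ne bc be k"
proof (cases "k \<in> {1..nc + ne}")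
  case True
  then obtain a where a: "a \<in> agents nc ne" "rank_of nc ne bc be a = k"
    by (rule agent_of_rank)
  then have "0 \<le> bid_of bc be a"
    using assms by (auto simp: agents_def)
  then show ?thesis
    using kth_bid_rank[OF a(1)] a(2) by simp
next
  case False
  then show ?thesis
    by (simp only: kth_bid_def if_False)
qed

text \<open>Reindexing by the rank bijection turns a sum over positions into a sum over all agents.
  The index set then no longer depends on \<open>a\<close>, which allows exchanging it with a sum
  over colluders.\<close>

lemma sum_kth_bid_after_rank:
  assumes "a \<in> agents nc ne"
  shows "(\<Sum>j = rank_of nc ne bc be a + 1..nc + ne. kth_bid nc ne bc be j * g j) =
    (\<Sum>c \<in> agents nc ne. if outranks bc be a c
       then bid_of bc be c * g (rank_of nc ne bc be c) else 0)"
proof -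
  let ?r = "rank_of nc ne bc be"
  have "(\<Sum>j = ?r a + 1..nc + ne. kth_bid nc ne bc be j * g j) =
      (\<Sum>j \<in> {1..nc + ne}. if ?r a < j then kth_bid nc ne bc be j * g j else 0)"
    by (subst sum.inter_filter[symmetric]) (auto intro: sum.cong)
  also have "\<dots> = (\<Sum>c \<in> agents nc ne.
      if ?r a < ?r c then kth_bid nc ne bc be (?r c) * g (?r c) else 0)"
    by (rule sum.reindex_bij_betw[OF bij_betw_rank, symmetric])
  also have "\<dots> = (\<Sum>c \<in> agents nc ne. if outranks bc be a c
       then bid_of bc be c * g (?r c) else 0)"
    using assms by (intro sum.cong) (auto simp: kth_bid_rank rank_less_iff_outranks)
  finally show ?thesis .
qed

section \<open>Closed form of the ranks\<close>

lemma outranks_External_iff: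
  assumes be: "antimono_on {1..ne} be" and "h \<in> {1..ne}" "l \<in> {1..ne}"
  shows "outranks bc be (External h) (External l) \<longleftrightarrow> h < l"
  using monotone_onD[OF be, of h l] monotone_onD[OF be, of l h] assms(2,3)
  by (cases h l rule: linorder_cases) (auto simp: outranks_def)

text \<open>Ahead of \<open>External h\<close> are the \<open>h - 1\<close> earlier external agents
  and, as ties favor colluders, every colluder bidding at least \<open>be h\<close>. The
  \<open>+ 1\<close> in the rank completes \<open>h - 1\<close> to \<open>h\<close>.\<close>

lemma rank_External:
  assumes "antimono_on {1..ne} be" "h \<in> {1..ne}"
  shows "rank_of nc ne bc be (External h) = h + card {i \<in> {1..nc}. be h \<le> bc i}"
proof -
  have "{a \<in> agents nc ne. outranks bc be a (External h)} =
      Colluder ` {i \<in> {1..nc}. be h \<le> bc i} \<union>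
      External ` {l \<in> {1..ne}. outranks bc be (External l) (External h)}"
    by (auto simp: agents_def outranks_def)
  also have "{l \<in> {1..ne}. outranks bc be (External l) (External h)} = {1..<h}"
    using assms outranks_External_iff by auto
  also have "card (Colluder ` {i \<in> {1..nc}. be h \<le> bc i} \<union> External ` {1..<h}) = card {i \<in> {1..nc}. be h \<le> bc i} + (h - 1)"
    by (subst card_Un_disjoint) (auto simp: card_image inj_on_def)
  finally show ?thesis
    using assms(2) by (simp add: rank_of_def)
qed

section \<open>Colluders bidding in decreasing order\<close>

context
  assumes bc: "antimono_on {1..nc} bc"
begin

lemma outranks_Colluder_iff:
  assumes "i \<in> {1..nc}" "l \<in> {1..nc}"
  shows "outranks bc be (Colluder i) (Colluder l) \<longleftrightarrow> i < l"
  using monotone_onD[OF bc, of i l] monotone_onD[OF bc, of l i] assms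
  by (cases i l rule: linorder_cases) (auto simp: outranks_def)

lemma rank_Colluder:
  assumes "i \<in> {1..nc}"
  shows "rank_of nc ne bc be (Colluder i) = i + n_above ne be (bc i)"
proof -
  have "{a \<in> agents nc ne. outranks bc be a (Colluder i)} =
      Colluder ` {l \<in> {1..nc}. outranks bc be (Colluder l) (Colluder i)} \<union>
      External ` {h \<in> {1..ne}. be h > bc i}"
    by (auto simp: agents_def outranks_def)
  also have "{l \<in> {1..nc}. outranks bc be (Colluder l) (Colluder i)} = {1..<i}"
    using assms outranks_Colluder_iff by auto
  also have "card (Colluder ` {1..<i} \<union> External ` {h \<in> {1..ne}. be h > bc i}) = (i - 1) + n_above ne be (bc i)"
    unfolding n_above_def by (subst card_Un_disjoint) (auto simp: card_image inj_on_def)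
  finally show ?thesis
    using assms by (simp add: rank_of_def)
qed

text \<open>With decreasing bids the set of colluders bidding at least \<open>t\<close> is an
  initial segment, so its cardinality is also the index of its last member.\<close>

lemma colluders_above_eq:
  "{i \<in> {1..nc}. t \<le> bc i} = {1..card {i \<in> {1..nc}. t \<le> bc i}}"
proof -
  define S where "S = {i \<in> {1..nc}. t \<le> bc i}"
  have "finite S"
    by (simp add: S_def)
  \<comment> \<open>Inserting 0 gives the maximum a meaning for empty \<open>S\<close>, and the
    interval is then empty as well.\<close>
  have "S = {1..Max (insert 0 S)}"
  proof (intro equalityI subsetI)
    fix i assume "i \<in> S"
    then show "i \<in> {1..Max (insert 0 S)}"
      using \<open>finite S\<close> by (auto simp: S_def)
  next
    fix i assume i: "i \<in> {1..Max (insert 0 S)}"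
    then have "Max (insert 0 S) \<in> S"
      using Max_in[of "insert 0 S"] \<open>finite S\<close> by auto
    then have "Max (insert 0 S) \<in> {1..nc}" "t \<le> bc (Max (insert 0 S))"
      unfolding S_def by blast+
    with i have "i \<in> {1..nc}" "bc (Max (insert 0 S)) \<le> bc i"
      using monotone_onD[OF bc, of i "Max (insert 0 S)"] by auto
    with \<open>t \<le> bc (Max (insert 0 S))\<close> show "i \<in> S"
      by (simp add: S_def)
  qed
  then have "S = {1..card S}"
    by (metis card_atLeastAtMost diff_Suc_1)
  then show ?thesis
    by (simp add: S_def)
qed

section \<open>GSP: the bid directly after a colluder\<close>

lemma kth_bid_after_Colluder:
  assumes i: "i \<in> {1..nc}"
    and bc_nonneg: "\<forall>i \<in> {1..nc}. 0 \<le> bc i" and be_nonneg: "\<forall>h \<in> {1..ne}. 0 \<le> be h"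
  shows "kth_bid nc ne bc be (rank_of nc ne bc be (Colluder i) + 1) =
    max (if i < nc then bc (i + 1) else 0) (max_below ne be (bc i))"
    (is "?next = max ?b' ?below")
proof -
  let ?k = "rank_of nc ne bc be (Colluder i)"
  let ?S = "be ` {h \<in> {1..ne}. be h \<le> bc i}"
  have i_agent: "Colluder i \<in> agents nc ne"
    using i by (simp add: agents_def)
  have below: "?below = (if ?S = {} then 0 else Max ?S)"
    by (simp only: max_below_def Let_def)
  have be_le: "be h \<le> ?below" if "h \<in> {1..ne}" "be h \<le> bc i" for h
  proof -
    have "be h \<in> ?S"
      using that by blast
    then show ?thesis
      unfolding below by (auto intro: Max_ge)
  qed
  have below_cases: "?below = 0 \<or> (\<exists>h \<in> {1..ne}. be h \<le> bc i \<and> ?below = be h)"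
  proof (cases "?S = {}")
    case False
    have "Max ?S \<in> ?S"
      using False by (intro Max_in) auto
    then have "?below \<in> ?S"
      unfolding below if_not_P[OF False] .
    then show ?thesis
      by blast
  qed (simp add: below)
  \<comment> \<open>An agent ranked after colluder \<open>i\<close> ensures that rank
    \<open>?k + 1\<close> is occupied; the holder of that rank is this agent or outranks it.\<close>
  have kth_ge: "bid_of bc be a \<le> ?next" if a: "a \<in> agents nc ne" "outranks bc be (Colluder i) a" for a
  proof -
    have ka: "?k < rank_of nc ne bc be a"
      using rank_less_iff_outranks[OF i_agent a(1)] a(2) by simp
    moreover have "rank_of nc ne bc be a \<in> {1..nc + ne}"
      using bij_betw_rank a(1) by (auto simp: bij_betw_def)
    ultimately have "?k + 1 \<in> {1..nc + ne}"
      by simp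
    then obtain c where c: "c \<in> agents nc ne" "rank_of nc ne bc be c = ?k + 1"
      by (rule agent_of_rank)
    have "bid_of bc be a \<le> bid_of bc be c"
    proof (cases "a = c")
      case False
      then have "outranks bc be c a"
        using ka c outranks_total rank_less_iff_outranks[OF a(1) c(1)] by fastforce
      then show ?thesis
        by (auto simp: outranks_def)
    qed simp
    then show ?thesis
      using kth_bid_rank[OF c(1)] c(2) by simp
  qed
  \<comment> \<open>The holder of the next rank is a later colluder, bidding at most as much as
    colluder \<open>i + 1\<close>, or an external agent bidding at most \<open>bc i\<close>. If the
    rank is vacant, \<open>kth_bid\<close> is 0 by default, and \<open>?b'\<close> is
    nonnegative.\<close>
  have next_le: "?next \<le> max ?b' ?below"
  proof (cases "?k + 1 \<in> {1..nc + ne}")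
    case True
    then obtain c where c: "c \<in> agents nc ne" "rank_of nc ne bc be c = ?k + 1"
      by (rule agent_of_rank)
    have out: "outranks bc be (Colluder i) c"
      using rank_less_iff_outranks[OF i_agent c(1)] c(2) by simp
    have "bid_of bc be c \<le> max ?b' ?below"
    proof (cases c)
      case (Colluder l)
      with c(1) have l: "l \<in> {1..nc}"
        by (auto simp: agents_def)
      with out Colluder i have "i < l"
        using outranks_Colluder_iff by blast
      with l i have "bc l \<le> bc (i + 1)"
        using monotone_onD[OF bc, of "i + 1" l] by auto
      with l \<open>i < l\<close> Colluder show ?thesis
        by auto
    next
      case (External h)
      with c(1) out show ?thesis
        using be_le[of h] by (auto simp: agents_def outranks_def le_max_iff_disj)
    qed
    then show ?thesis
      using kth_bid_rank[OF c(1)] c(2) by simp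
  next
    case False
    have "0 \<le> ?b'"
      using bc_nonneg by simp
    with False show ?thesis
      by (simp only: kth_bid_def if_False le_max_iff_disj simp_thms)
  qed
  \<comment> \<open>This settles the cases where \<open>?b'\<close> or \<open>?below\<close> takes
    its default value 0.\<close>
  have next_nonneg: "0 \<le> ?next"
    using bc_nonneg be_nonneg by (rule kth_bid_nonneg)
  have "?b' \<le> ?next"
    using next_nonneg kth_ge[of "Colluder (i + 1)"] i outranks_Colluder_iff[of i "i + 1"]
    by (auto simp: agents_def)
  \<comment> \<open>By the tie rule, colluder \<open>i\<close> outranks every external agent bidding
    at most \<open>bc i\<close>, so \<open>kth_ge\<close> applies to the one attaining the
    maximum.\<close>
  moreover have "?below \<le> ?next"
    using below_cases next_nonneg kth_ge[of "External h" for h]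
    by (force simp: agents_def outranks_def)
  ultimately show ?thesis
    using next_le by (simp add: antisym)
qed

section \<open>VCG: total payment regrouped by the agent charged\<close>

lemma sum_payment_VCG:
  assumes m: "m \<le> nc + ne" and lam: "\<forall>k > m. lam k = 0" and be: "antimono_on {1..ne} be"
  shows "(\<Sum>i = 1..nc. payment VCG nc ne m lam bc be (Colluder i)) =
    (\<Sum>i = 1..nc. real (i - 1) * bc i *
       (lam (i + n_above ne be (bc i) - 1) - lam (i + n_above ne be (bc i)))) +
    (\<Sum>h = 1..ne. let c = card {i \<in> {1..nc}. be h \<le> bc i}
       in real c * be h * (lam (h + c - 1) - lam (h + c)))"
proof -
  let ?r = "rank_of nc ne bc be"
  let ?g = "\<lambda>j. lam (j - 1) - lam j"
  let ?A = "agents nc ne"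
  have pay: "payment VCG nc ne m lam bc be (Colluder i) =
      (\<Sum>a \<in> ?A. if outranks bc be (Colluder i) a then bid_of bc be a * ?g (?r a) else 0)"
    if "i \<in> {1..nc}" for i
  proof -
    let ?k = "?r (Colluder i)"
    let ?f = "\<lambda>j. kth_bid nc ne bc be j * ?g j"
    \<comment> \<open>For \<open>m + 1 < j\<close> both click-through rates vanish; for
      \<open>nc + ne < j\<close> the bid is 0 by default. Hence the upper limit \<open>m + 1\<close>
      may be replaced by \<open>nc + ne\<close>.\<close>
    have f_zero: "?f j = 0" if "m + 1 < j \<or> nc + ne < j" for j
      using that lam by (auto simp: kth_bid_def)
    have "payment VCG nc ne m lam bc be (Colluder i) = (\<Sum>j = ?k + 1..nc + ne. ?f j)"
    proof (cases "?k \<le> m")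
      case True
      \<comment> \<open>Neither limit dominates the other: \<open>m + 1\<close> exceeds
        \<open>nc + ne\<close> if \<open>m = nc + ne\<close>. Extending to
        \<open>nc + ne + 1\<close> first covers both cases.\<close>
      have "(\<Sum>j = ?k + 1..m + 1. ?f j) = (\<Sum>j = ?k + 1..nc + ne + 1. ?f j)"
        using m by (intro sum.mono_neutral_left ballI f_zero) auto
      also have "\<dots> = (\<Sum>j = ?k + 1..nc + ne. ?f j)"
        by (intro sum.mono_neutral_right ballI f_zero) auto
      finally show ?thesis
        using True by (simp add: Let_def)
    next
      case False
      then have "(\<Sum>j = ?k + 1..nc + ne. ?f j) = 0"
        using lam by (intro sum.neutral) auto
      then show ?thesis
        using False by (simp add: Let_def)
    qed
    also have "\<dots> = (\<Sum>a \<in> ?A.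
        if outranks bc be (Colluder i) a then bid_of bc be a * ?g (?r a) else 0)"
      using that by (intro sum_kth_bid_after_rank) (simp add: agents_def)
    finally show ?thesis .
  qed
  have "(\<Sum>i = 1..nc. payment VCG nc ne m lam bc be (Colluder i)) =
      (\<Sum>i = 1..nc. \<Sum>a \<in> ?A.
        if outranks bc be (Colluder i) a then bid_of bc be a * ?g (?r a) else 0)"
    by (intro sum.cong refl pay)
  also have "\<dots> = (\<Sum>a \<in> ?A. \<Sum>i = 1..nc.
        if outranks bc be (Colluder i) a then bid_of bc be a * ?g (?r a) else 0)"
    by (rule sum.swap)
  \<comment> \<open>The summand depends on \<open>i\<close> only through the condition, so each
    agent is charged once per colluder outranking it.\<close>
  also have "\<dots> = (\<Sum>a \<in> ?A. real (card {i \<in> {1..nc}. outranks bc be (Colluder i) a}) *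
      (bid_of bc be a * ?g (?r a)))"
    by (simp only: sum.inter_filter[symmetric, OF finite_atLeastAtMost] sum_constant)
  also have "\<dots> =
      (\<Sum>l = 1..nc. real (card {i \<in> {1..nc}. outranks bc be (Colluder i) (Colluder l)}) *
        (bc l * ?g (?r (Colluder l)))) +
      (\<Sum>h = 1..ne. real (card {i \<in> {1..nc}. outranks bc be (Colluder i) (External h)}) *
        (be h * ?g (?r (External h))))"
    by (simp add: sum_agents)
  also have "(\<Sum>l = 1..nc. real (card {i \<in> {1..nc}. outranks bc be (Colluder i) (Colluder l)}) *
        (bc l * ?g (?r (Colluder l)))) =
      (\<Sum>i = 1..nc. real (i - 1) * bc i *
       (lam (i + n_above ne be (bc i) - 1) - lam (i + n_above ne be (bc i))))"
  proof (intro sum.cong refl)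
    fix l assume l: "l \<in> {1..nc}"
    then have "{i \<in> {1..nc}. outranks bc be (Colluder i) (Colluder l)} = {1..<l}"
      using outranks_Colluder_iff by auto
    then show "real (card {i \<in> {1..nc}. outranks bc be (Colluder i) (Colluder l)}) *
        (bc l * ?g (?r (Colluder l))) = real (l - 1) * bc l *
       (lam (l + n_above ne be (bc l) - 1) - lam (l + n_above ne be (bc l)))"
      using l by (simp add: rank_Colluder)
  qed
  also have "(\<Sum>h = 1..ne. real (card {i \<in> {1..nc}. outranks bc be (Colluder i) (External h)}) *
        (be h * ?g (?r (External h)))) =
      (\<Sum>h = 1..ne. let c = card {i \<in> {1..nc}. be h \<le> bc i}
       in real c * be h * (lam (h + c - 1) - lam (h + c)))"
  proof (intro sum.cong refl)
    fix h assume h: "h \<in> {1..ne}"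
    have "{i \<in> {1..nc}. outranks bc be (Colluder i) (External h)} = {i \<in> {1..nc}. be h \<le> bc i}"
      by (auto simp: outranks_def)
    then show "real (card {i \<in> {1..nc}. outranks bc be (Colluder i) (External h)}) *
        (be h * ?g (?r (External h))) = (let c = card {i \<in> {1..nc}. be h \<le> bc i}
       in real c * be h * (lam (h + c - 1) - lam (h + c)))"
      using h by (simp add: rank_External[OF be] Let_def)
  qed
  finally show ?thesis .
qed

text \<open>The half-open intervals between consecutive colluder bids, the last one ending at 0, are
  disjoint and cover every positive bid not exceeding the first colluder's. The interval containing
  \<open>be h\<close> belongs to the last colluder bidding at least \<open>be h\<close>, whose index
  is the count \<open>c\<close>.\<close>

lemma sum_External_by_predecessor:
  assumes be_nonneg: "\<forall>h \<in> {1..ne}. 0 \<le> be h"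
  shows "(\<Sum>i = 1..nc. \<Sum>h \<in> {h \<in> {1..ne}. be h \<in> {(if i < nc then bc (i + 1) else 0)<..bc i}}.
      real i * be h * g (h + i)) =
    (\<Sum>h = 1..ne. let c = card {i \<in> {1..nc}. be h \<le> bc i} in real c * be h * g (h + c))"
proof -
  let ?b' = "\<lambda>i. if i < nc then bc (i + 1) else 0"
  have "(\<Sum>i = 1..nc. \<Sum>h \<in> {h \<in> {1..ne}. be h \<in> {?b' i<..bc i}}. real i * be h * g (h + i)) =
      (\<Sum>i = 1..nc. \<Sum>h = 1..ne. if be h \<in> {?b' i<..bc i} then real i * be h * g (h + i) else 0)"
    by (rule sum.cong[OF refl sum.inter_filter]) simp
  also have "\<dots> =
      (\<Sum>h = 1..ne. \<Sum>i = 1..nc. if be h \<in> {?b' i<..bc i} then real i * be h * g (h + i) else 0)"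
    by (rule sum.swap)
  also have "\<dots> = (\<Sum>h = 1..ne. let c = card {i \<in> {1..nc}. be h \<le> bc i} in real c * be h * g (h + c))"
  proof (intro sum.cong refl)
    fix h assume h: "h \<in> {1..ne}"
    define c where "c = card {i \<in> {1..nc}. be h \<le> bc i}"
    have above: "be h \<le> bc i \<longleftrightarrow> i \<le> c" if "i \<in> {1..nc}" for i
    proof -
      have "i \<in> {i \<in> {1..nc}. be h \<le> bc i} \<longleftrightarrow> i \<in> {1..c}"
        unfolding c_def by (rule eqset_imp_iff[OF colluders_above_eq])
      then show ?thesis
        using that by simp
    qed
    have "c \<le> nc"
    proof -
      have "card {i \<in> {1..nc}. be h \<le> bc i} \<le> card {1..nc}"
        by (rule card_mono) auto
      then show ?thesis
        by (simp add: c_def)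
    qed
    show "(\<Sum>i = 1..nc. if be h \<in> {?b' i<..bc i} then real i * be h * g (h + i) else 0) =
        (let c = card {i \<in> {1..nc}. be h \<le> bc i} in real c * be h * g (h + c))"
    \<comment> \<open>A zero bid may lie in none of the intervals, but every term carries the factor
      \<open>be h\<close>.\<close>
    proof (cases "be h = 0")
      case True
      then have "(\<Sum>i = 1..nc. if be h \<in> {?b' i<..bc i} then real i * be h * g (h + i) else 0) = 0"
        by (intro sum.neutral) auto
      with True show ?thesis
        by (simp only: mult_zero_left mult_zero_right Let_def)
    next
      case False
      with h be_nonneg have "0 < be h"
        by (simp add: order_less_le)
      have "be h \<in> {?b' i<..bc i} \<longleftrightarrow> i = c" if i: "i \<in> {1..nc}" for i
      proof (cases "i < nc")
        case True
        then show ?thesis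
          using above[of i] above[of "i + 1"] i by auto
      next
        case False
        then show ?thesis
          using above[of i] i \<open>c \<le> nc\<close> \<open>0 < be h\<close> by auto
      qed
      then have "(\<Sum>i = 1..nc. if be h \<in> {?b' i<..bc i} then real i * be h * g (h + i) else 0) =
          (\<Sum>i = 1..nc. if i = c then real i * be h * g (h + i) else 0)"
        by (intro sum.cong) auto
      \<comment> \<open>If \<open>c = 0\<close>, no index of the sum matches, and the factor
        \<open>real c\<close> makes the right-hand side vanish too.\<close>
      also have "\<dots> = real c * be h * g (h + c)"
        using \<open>c \<le> nc\<close> by (cases "c = 0") auto
      finally show ?thesis
        by (simp add: c_def Let_def)
    qed
  qed
  finally show ?thesis .
qed

section \<open>Node weights against revenues and payments\<close>

lemma sum_node_weight:
  assumes m: "m \<le> nc + ne" and lam: "\<forall>k > m. lam k = 0" and be: "antimono_on {1..ne} be"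
    and bc_nonneg: "\<forall>i \<in> {1..nc}. 0 \<le> bc i" and be_nonneg: "\<forall>h \<in> {1..ne}. 0 \<le> be h"
  shows "(\<Sum>i = 1..nc. node_weight M ne lam v y x be i (bc i) (if i < nc then bc (i + 1) else 0)) =
    (\<Sum>i = 1..nc. y i * revenue nc ne lam v bc be i - x * payment M nc ne m lam bc be (Colluder i))"
proof (cases M)
  case GSP
  \<comment> \<open>For GSP the equality holds for each colluder separately.\<close>
  have "node_weight GSP ne lam v y x be i (bc i) (if i < nc then bc (i + 1) else 0) =
      y i * revenue nc ne lam v bc be i - x * payment GSP nc ne m lam bc be (Colluder i)"
    if "i \<in> {1..nc}" for i
    using kth_bid_after_Colluder[OF that bc_nonneg be_nonneg] that
    by (simp add: revenue_def Let_def rank_Colluder algebra_simps)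
  with GSP show ?thesis
    by (auto intro: sum.cong)
next
  case VCG
  let ?n = "\<lambda>i. i + n_above ne be (bc i)"
  let ?b' = "\<lambda>i. if i < nc then bc (i + 1) else 0"
  let ?own = "\<lambda>i. real (i - 1) * bc i * (lam (?n i - 1) - lam (?n i))"
  let ?ext = "\<lambda>i. \<Sum>h \<in> {h \<in> {1..ne}. be h \<in> {?b' i<..bc i}}.
      real i * be h * (lam (h + i - 1) - lam (h + i))"
  have "(\<Sum>i = 1..nc. node_weight VCG ne lam v y x be i (bc i) (?b' i)) =
      (\<Sum>i = 1..nc. y i * lam (?n i) * v i - x * (?own i + ?ext i))"
    by (simp only: node_weight.simps)
  also have "\<dots> = (\<Sum>i = 1..nc. y i * lam (?n i) * v i) - x * ((\<Sum>i = 1..nc. ?own i) + (\<Sum>i = 1..nc. ?ext i))"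
    by (simp only: sum_subtractf sum_distrib_left sum.distrib distrib_left)
  \<comment> \<open>The two parts of the weights match the charges on colluders and on external
    agents in \<open>sum_payment_VCG\<close>, but only as totals.\<close>
  also have "(\<Sum>i = 1..nc. ?own i) + (\<Sum>i = 1..nc. ?ext i) =
      (\<Sum>i = 1..nc. payment VCG nc ne m lam bc be (Colluder i))"
    unfolding sum_payment_VCG[OF m lam be]
      sum_External_by_predecessor[OF be_nonneg, of "\<lambda>j. lam (j - 1) - lam j"] ..
  also have "(\<Sum>i = 1..nc. y i * lam (?n i) * v i) = (\<Sum>i = 1..nc. y i * revenue nc ne lam v bc be i)"
    by (intro sum.cong) (simp_all add: revenue_def rank_Colluder)
  finally show ?thesis
    using VCG by (simp only: sum_subtractf sum_distrib_left)
qed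

end

end

section \<open>Paths of the bid graph\<close>

definition bid_path :: "nat \<Rightarrow> (nat \<Rightarrow> real) \<Rightarrow> (vertex \<times> vertex) awalk" where
  "bid_path nc b = (Source, Node 1 (b 1)) #
     map (\<lambda>i. (Node i (b i), Node (i + 1) (b (i + 1)))) [1..<nc] @ [(Node nc (b nc), Sink)]"

lemma bid_graph_sel [simp]: "tail (bid_graph nc d bb) = fst" "head (bid_graph nc d bb) = snd"
  by (simp_all add: bid_graph_def)

text \<open>Arcs are pairs of vertices, so a walk is recovered from its vertex sequence. This makes
  the path through prescribed nodes unique.\<close>

lemma cas_bid_graph_eq_zip:
  assumes "pre_digraph.cas (bid_graph nc d bb) u p w"
  shows "p = zip (pre_digraph.awalk_verts (bid_graph nc d bb) u p)
                 (tl (pre_digraph.awalk_verts (bid_graph nc d bb) u p))"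
  using assms
proof (induction p arbitrary: u)
  case Nil
  then show ?case
    by (simp add: pre_digraph.awalk_verts.simps)
next
  case (Cons e p)
  then have *: "pre_digraph.cas (bid_graph nc d bb) (snd e) p w"
    by (simp add: pre_digraph.cas.simps)
  have "\<exists>vs. pre_digraph.awalk_verts (bid_graph nc d bb) (snd e) p = snd e # vs"
    using * by (cases p) (auto simp: pre_digraph.awalk_verts.simps pre_digraph.cas.simps)
  with Cons.IH[OF *] show ?case
    by (auto simp: pre_digraph.awalk_verts.simps)
qed

lemma cas_bid_path:
  assumes "1 \<le> nc"
  shows "pre_digraph.cas (bid_graph nc d bb) Source (bid_path nc b) Sink"
    and "pre_digraph.awalk_verts (bid_graph nc d bb) Source (bid_path nc b) =
      Source # map (\<lambda>i. Node i (b i)) [1..<nc + 1] @ [Sink]"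
proof -
  \<comment> \<open>The claim is generalized to the walk starting at node \<open>k\<close> and
    proved by induction from \<open>k = nc\<close> downwards.\<close>
  have suffix: "pre_digraph.cas (bid_graph nc d bb) (Node k (b k))
        (map (\<lambda>i. (Node i (b i), Node (i + 1) (b (i + 1)))) [k..<nc] @ [(Node nc (b nc), Sink)]) Sink
      \<and> pre_digraph.awalk_verts (bid_graph nc d bb) (Node k (b k))
        (map (\<lambda>i. (Node i (b i), Node (i + 1) (b (i + 1)))) [k..<nc] @ [(Node nc (b nc), Sink)])
        = map (\<lambda>i. Node i (b i)) [k..<nc + 1] @ [Sink]" if "k \<le> nc" for k
    using that
  proof (induction rule: inc_induct)
    case base
    then show ?case
      by (simp add: pre_digraph.cas.simps pre_digraph.awalk_verts.simps)
  next
    case (step k)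
    then show ?case
      by (simp add: pre_digraph.cas.simps pre_digraph.awalk_verts.simps upt_conv_Cons del: upt_Suc)
  qed
  from suffix[OF assms] show "pre_digraph.cas (bid_graph nc d bb) Source (bid_path nc b) Sink"
    "pre_digraph.awalk_verts (bid_graph nc d bb) Source (bid_path nc b) =
      Source # map (\<lambda>i. Node i (b i)) [1..<nc + 1] @ [Sink]"
    by (simp_all add: bid_path_def pre_digraph.cas.simps pre_digraph.awalk_verts.simps del: upt_Suc)
qed

lemma path_through_imp_eq_bid_path:
  assumes "1 \<le> nc" "path_through nc d bb p b"
  shows "p = bid_path nc b"
proof -
  have "pre_digraph.cas (bid_graph nc d bb) Source p Sink"
    using assms(2) by (simp add: path_through_def pre_digraph.apath_def pre_digraph.awalk_def)
  from cas_bid_graph_eq_zip[OF this] cas_bid_graph_eq_zip[OF cas_bid_path(1)[OF assms(1), of d bb b]]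
  show ?thesis
    using assms(2) by (simp only: path_through_def cas_bid_path(2)[OF assms(1)])
qed

lemma awalk_cost_bid_path:
  assumes "1 \<le> nc"
  shows "wf_digraph.awalk_cost (arc_weight M ne lam v y x be) (bid_path nc b) =
    (\<Sum>i = 1..nc. node_weight M ne lam v y x be i (b i) (if i < nc then b (i + 1) else 0))"
proof -
  let ?w = "\<lambda>i. node_weight M ne lam v y x be i (b i) (if i < nc then b (i + 1) else 0)"
  have "wf_digraph.awalk_cost (arc_weight M ne lam v y x be) (bid_path nc b) =
      sum_list (map (\<lambda>i. node_weight M ne lam v y x be i (b i) (b (i + 1))) [1..<nc]) + ?w nc"
    by (simp add: wf_digraph.awalk_cost_def[OF wf_digraph_bid_graph[OF assms]] bid_path_def comp_def)
  \<comment> \<open>The arc out of the source costs 0. The conditional takes its default 0 only at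
    \<open>nc\<close>, which is the weight of the arc into the sink.\<close>
  also have "map (\<lambda>i. node_weight M ne lam v y x be i (b i) (b (i + 1))) [1..<nc] = map ?w [1..<nc]"
    by simp
  also have "sum_list \<dots> + ?w nc = sum_list (map ?w [1..<Suc nc])"
    using assms by simp
  also have "\<dots> = (\<Sum>i = 1..nc. ?w i)"
    by (simp only: sum_list_distinct_conv_sum_set distinct_upt set_upt atLeastLessThanSuc_atLeastAtMost)
  finally show ?thesis .
qed

section \<open>Paths and decreasing bidding strategies\<close>

lemma path_through_imp_antimono:
  assumes nc: "1 \<le> nc" and bb: "antimono_on {1..d} bb" and p: "path_through nc d bb p b"
  shows "antimono_on {1..nc} b"
proof -
  have arcs: "set (bid_path nc b) \<subseteq> arcs (bid_graph nc d bb)"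
    using p path_through_imp_eq_bid_path[OF nc p]
    by (simp add: path_through_def pre_digraph.apath_def pre_digraph.awalk_def)
  \<comment> \<open>An arc between consecutive nodes requires bid indices in increasing order, and
    \<open>bb\<close> is decreasing; the order of the bids is thus enforced by the graph.\<close>
  have decrease: "b (Suc i) \<le> b i" if i: "1 \<le> i" "i < nc" for i
  proof -
    have "(Node i (b i), Node (i + 1) (b (i + 1))) \<in> arcs (bid_graph nc d bb)"
      using i by (intro subsetD[OF arcs]) (auto simp: bid_path_def)
    then obtain j' j where "j' \<in> {1..d}" "j \<in> {1..d}" "j' \<le> j" "b i = bb j'" "b (i + 1) = bb j"
      by (auto simp: bid_graph_def)
    then show ?thesis
      using monotone_onD[OF bb, of j' j] by simp
  qed
  show ?thesis
  proof (rule monotone_onI)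
    fix k l assume kl: "k \<in> {1..nc}" "l \<in> {1..nc}" "k \<le> l"
    from \<open>k \<le> l\<close> have "l \<le> nc \<longrightarrow> b l \<le> b k"
    proof (induction rule: dec_induct)
      case (step n)
      then show ?case
        using decrease[of n] kl(1) by auto
    qed simp
    with kl(2) show "b l \<le> b k"
      by simp
  qed
qed

text \<open>Arcs compare indices while strategies compare bids. Since the bid values are distinct,
  decreasing bids force increasing indices, so all required arcs exist.\<close>

lemma path_through_bid_path:
  assumes nc: "1 \<le> nc" and bb: "inj_on bb {1..d}" "antimono_on {1..d} bb"
    and js: "\<forall>i \<in> {1..nc}. js i \<in> {1..d}" and anti: "antimono_on {1..nc} (\<lambda>i. bb (js i))"
  shows "path_through nc d bb (bid_path nc (\<lambda>i. bb (js i))) (\<lambda>i. bb (js i))"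
proof -
  have js_le: "js i \<le> js (i + 1)" if i: "1 \<le> i" "i < nc" for i
  proof (rule ccontr)
    assume "\<not> js i \<le> js (i + 1)"
    moreover have mem: "js i \<in> {1..d}" "js (i + 1) \<in> {1..d}"
      using js i by auto
    ultimately have "bb (js i) \<le> bb (js (i + 1))"
      using monotone_onD[OF bb(2), of "js (i + 1)" "js i"] by simp
    moreover have "bb (js (i + 1)) \<le> bb (js i)"
      using monotone_onD[OF anti, of i "i + 1"] i by simp
    ultimately have "js i = js (i + 1)"
      using inj_onD[OF bb(1)] mem by simp
    with \<open>\<not> js i \<le> js (i + 1)\<close> show False
      by simp
  qed
  have "(Source, Node 1 (bb (js 1))) \<in> arcs (bid_graph nc d bb)"
    "(Node nc (bb (js nc)), Sink) \<in> arcs (bid_graph nc d bb)"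
    using js nc by (auto simp: bid_graph_def)
  moreover have "(Node i (bb (js i)), Node (i + 1) (bb (js (i + 1)))) \<in> arcs (bid_graph nc d bb)"
    if "1 \<le> i" "i < nc" for i
  proof -
    have "js i \<in> {1..d}" "js (i + 1) \<in> {1..d}"
      using js that by auto
    with js_le[OF that] that show ?thesis
      unfolding bid_graph_def pre_digraph.select_convs by blast
  qed
  ultimately have "set (bid_path nc (\<lambda>i. bb (js i))) \<subseteq> arcs (bid_graph nc d bb)"
    by (auto simp: bid_path_def)
  moreover have "Source \<in> verts (bid_graph nc d bb)"
    by (simp add: bid_graph_def)
  \<comment> \<open>Nodes carry the number of their colluder, so no vertex repeats even when bids
    coincide.\<close>
  moreover have "distinct (Source # map (\<lambda>i. Node i (bb (js i))) [1..<nc + 1] @ [Sink])"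
    by (auto simp: distinct_map inj_on_def simp del: upt_Suc)
  ultimately show ?thesis
    unfolding path_through_def pre_digraph.apath_def pre_digraph.awalk_def
    using cas_bid_path[OF nc, of d bb "\<lambda>i. bb (js i)"] by simp
qed

theorem lemma2:
  fixes M :: mechanism
    and nc ne m d :: nat
    and lam v y be bb :: "nat \<Rightarrow> real"
    and x :: real
  assumes "1 \<le> nc"
    and "m \<le> nc + ne"
    and "\<forall>k \<in> {1..m}. lam k \<in> {0..1}"
    and "antimono_on {1..m} lam"
    and "\<forall>k > m. lam k = 0"
    and "\<forall>i \<in> {1..nc}. v i \<in> {0..1}"
    and "\<forall>h \<in> {1..ne}. be h \<in> {0..1}"
    and "antimono_on {1..ne} be"
    and "\<forall>i \<in> {1..nc}. 0 \<le> y i"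
    and "0 \<le> x"
    and "antimono_on {1..nc} (\<lambda>i. y i * v i)"
    and "\<forall>j \<in> {1..d}. bb j \<in> {0..1}"
    and "inj_on bb {1..d}"
    and "antimono_on {1..d} bb"
  shows
    "(\<forall>p js. (\<forall>i \<in> {1..nc}. js i \<in> {1..d}) \<and> path_through nc d bb p (\<lambda>i. bb (js i)) \<longrightarrow>
        wf_digraph.awalk_cost (arc_weight M ne lam v y x be) p =
        (\<Sum>i = 1..nc. y i * revenue nc ne lam v (\<lambda>i. bb (js i)) be i
                     - x * payment M nc ne m lam (\<lambda>i. bb (js i)) be (Colluder i)))
     \<and> (\<forall>js. (\<forall>i \<in> {1..nc}. js i \<in> {1..d}) \<and> antimono_on {1..nc} (\<lambda>i. bb (js i)) \<longrightarrow>
        (\<exists>p. path_through nc d bb p (\<lambda>i. bb (js i))))"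
proof (intro conjI allI impI)
  fix p js
  assume "(\<forall>i \<in> {1..nc}. js i \<in> {1..d}) \<and> path_through nc d bb p (\<lambda>i. bb (js i))"
  then have js: "\<forall>i \<in> {1..nc}. js i \<in> {1..d}" and p: "path_through nc d bb p (\<lambda>i. bb (js i))"
    by auto
  have "antimono_on {1..nc} (\<lambda>i. bb (js i))"
    by (rule path_through_imp_antimono) (use assms p in auto)
  moreover have "\<forall>i \<in> {1..nc}. 0 \<le> bb (js i)" "\<forall>h \<in> {1..ne}. 0 \<le> be h"
    using js assms by auto
  ultimately show "wf_digraph.awalk_cost (arc_weight M ne lam v y x be) p =
        (\<Sum>i = 1..nc. y i * revenue nc ne lam v (\<lambda>i. bb (js i)) be i
                     - x * payment M nc ne m lam (\<lambda>i. bb (js i)) be (Colluder i))"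
    unfolding path_through_imp_eq_bid_path[OF \<open>1 \<le> nc\<close> p] awalk_cost_bid_path[OF \<open>1 \<le> nc\<close>]
    using assms by (intro sum_node_weight)
next
  fix js
  assume "(\<forall>i \<in> {1..nc}. js i \<in> {1..d}) \<and> antimono_on {1..nc} (\<lambda>i. bb (js i))"
  then show "\<exists>p. path_through nc d bb p (\<lambda>i. bb (js i))"
    using path_through_bid_path assms by blast
qed

end
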